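(* Let $A \in M_n(\mathbb{C})$. Then the following are equivalent: (i) $A$ is a core-EP matrix; (ii) $A^{\dagger,d,\dagger} = (A^{d})^{3}$; (iii) $A^{\dagger,d,\dagger}A^{d,\dagger} = (A^{d})^{4}$; (iv) $A^{\dagger,d,\dagger}A = AA^{\dagger,d,\dagger}$; (v) $A^{\dagger,d,\dagger}A_c = A_cA^{\dagger,d,\dagger}$; (vi) $A^{\dagger,d,\dagger}A^{d} = A^{d}A^{\dagger,d,\dagger}$; (vii) $A^{\dagger,d,\dagger}A^{d} = (A^{d,\dagger})^{4}$.
   Context: $A^{\dagger}$ is the Moore-Penrose inverse and $A^{d}$ the Drazin inverse of $A$. The core part of $A$ is $A_c = AA^{d}A$. A matrix $A$ is called core-EP if $A^{\dagger}A_c = A_cA^{\dagger}$. The DMP inverse of $A$ is $A^{d,\dagger} = A^{d}AA^{\dagger}$. The MPDMP matrix associated with $A$ is $A^{\dagger,d,\dagger} := A^{\dagger}A^{d}A^{\dagger}$. *)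

theory Defs
  imports "HOL-Analysis.Analysis"
begin

text \<open>Matrices are elements of \<open>complex^'n^'n\<close>. On this type the library's \<open>*\<close> and \<open>^\<close> act
  entrywise, so the matrix product is \<open>**\<close> and matrix powers need a function of their own.\<close>

definition mat_power :: "complex^'n^'n \<Rightarrow> nat \<Rightarrow> complex^'n^'n" where
  "mat_power A k = (((**) A) ^^ k) (mat 1)"

definition conj_transpose :: "complex^'n^'m \<Rightarrow> complex^'m^'n" where
  "conj_transpose A = map_matrix cnj (transpose A)"

definition is_moore_penrose :: "complex^'n^'m \<Rightarrow> complex^'m^'n \<Rightarrow> bool" where
  "is_moore_penrose A X \<longleftrightarrow>
     A ** X ** A = A \<and>
     X ** A ** X = X \<and>
     conj_transpose (A ** X) = A ** X \<and>
     conj_transpose (X ** A) = X ** A"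

text \<open>Every complex matrix has exactly one Moore-Penrose inverse, and every square one exactly one
  Drazin inverse, so both definite descriptions below denote.\<close>

definition moore_penrose :: "complex^'n^'m \<Rightarrow> complex^'m^'n" where
  "moore_penrose A = (THE X. is_moore_penrose A X)"

text \<open>Drazin's original conditions: the last one is required for some exponent \<open>k\<close>. It then holds
  for exactly those \<open>k\<close> that are at least the index of \<open>A\<close>, so requiring it at the
  index gives the same inverse.\<close>

definition is_drazin :: "complex^'n^'n \<Rightarrow> complex^'n^'n \<Rightarrow> bool" where
  "is_drazin A X \<longleftrightarrow>
     X ** A ** X = X \<and>
     A ** X = X ** A \<and>
     (\<exists>k. mat_power A (Suc k) ** X = mat_power A k)"

definition drazin :: "complex^'n^'n \<Rightarrow> complex^'n^'n" where
  "drazin A = (THE X. is_drazin A X)"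

definition core_part :: "complex^'n^'n \<Rightarrow> complex^'n^'n" where
  "core_part A = A ** drazin A ** A"

definition core_EP :: "complex^'n^'n \<Rightarrow> bool" where
  "core_EP A \<longleftrightarrow> moore_penrose A ** core_part A = core_part A ** moore_penrose A"

definition DMP :: "complex^'n^'n \<Rightarrow> complex^'n^'n" where
  "DMP A = drazin A ** A ** moore_penrose A"

definition MPDMP :: "complex^'n^'n \<Rightarrow> complex^'n^'n" where
  "MPDMP A = moore_penrose A ** drazin A ** moore_penrose A"

end

theory Submission
  imports Defs
begin

text \<open>Put \<open>D\<close> for the Drazin inverse of \<open>A\<close>, \<open>M\<close> for its Moore-Penrose inverse, and
  \<open>P = A D\<close>, \<open>Q = M A\<close>, \<open>R = A M\<close>. Since \<open>P Q = P\<close> and \<open>R P = P\<close>, multiplying the core-EP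
  equation \<open>Q P = P R\<close> by \<open>P\<close> shows that it is equivalent to \<open>Q P = P = P R\<close>. As
  \<open>M D M = Q D\<^sup>3 R\<close>, each of the other conditions reads \<open>Q D\<^sup>k = D\<^sup>k R\<close> or \<open>Q D\<^sup>k R = D\<^sup>k\<close>, which is
  again equivalent to \<open>Q P = P = P R\<close>.

  Existence of the Drazin inverse comes from a relation \<open>A\<^sup>k = A\<^sup>k\<^sup>+\<^sup>1 Y\<close> with \<open>Y\<close> a polynomial
  in \<open>A\<close>, for which \<open>A\<^sup>k Y\<^sup>k\<^sup>+\<^sup>1\<close> is a Drazin inverse. Writing \<open>G\<close> for the Drazin inverse of
  \<open>H = A\<^sup>* A\<close>, the Moore-Penrose inverse of \<open>A\<close> is \<open>G A\<^sup>*\<close>.\<close>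

lemma matrix_add_rdistrib: "(A + B) ** C = A ** C + B ** C"
  by (simp add: matrix_matrix_mult_def vec_eq_iff sum.distrib distrib_right)

lemma matrix_diff_ldistrib:
  fixes B C :: "'a::ring_1^'n^'m"
  shows "A ** (B - C) = A ** B - A ** C"
  by (simp add: matrix_matrix_mult_def vec_eq_iff sum_subtractf right_diff_distrib)

section \<open>Matrix powers\<close>

lemma mat_power_0 [simp]: "mat_power A 0 = mat 1"
  by (simp add: mat_power_def)

lemma mat_power_Suc: "mat_power A (Suc k) = A ** mat_power A k"
  by (simp add: mat_power_def)

lemma mat_power_1 [simp]: "mat_power A (Suc 0) = A"
  by (simp add: mat_power_Suc)

lemma mat_power_add: "mat_power A (m + n) = mat_power A m ** mat_power A n"
  by (induction m) (simp_all add: mat_power_Suc matrix_mul_assoc)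

lemma mat_power_commute:
  assumes "A ** X = X ** A"
  shows "mat_power A k ** X = X ** mat_power A k"
proof (induction k)
  case (Suc k)
  have "mat_power A (Suc k) ** X = A ** (mat_power A k ** X)"
    by (simp add: mat_power_Suc matrix_mul_assoc)
  also have "\<dots> = (A ** X) ** mat_power A k"
    by (simp add: Suc matrix_mul_assoc)
  also have "\<dots> = X ** mat_power A (Suc k)"
    by (simp add: assms mat_power_Suc matrix_mul_assoc)
  finally show ?case .
qed simp

lemma mat_power_Suc2: "mat_power A (Suc k) = mat_power A k ** A"
  by (simp add: mat_power_Suc mat_power_commute)

section \<open>The Drazin inverse\<close>

text \<open>The real spans of the tails A^k, A^(k+1), ... shrink as \<open>k\<close> grows. Where
  the dimension is least the next span is equal, so A^k is a combination of strictly higher powers,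
  from which A^(k+1) factors out. Of the cofactor \<open>Y\<close>, a polynomial in A, only
  commutation with A is kept.\<close>

lemma mat_power_stabilizes:
  fixes A :: "complex^'n^'n"
  obtains k Y where "A ** Y = Y ** A" and "mat_power A k = mat_power A (Suc k) ** Y"
proof -
  define V where "V k = span (mat_power A ` {k..})" for k
  obtain k where k: "\<And>j. dim (V k) \<le> dim (V j)"
    using ex_has_least_nat[of "\<lambda>_. True" 0 "\<lambda>k. dim (V k)"] by auto
  have "V (Suc k) \<subseteq> V k"
    unfolding V_def by (intro span_mono image_mono) auto
  then have "V (Suc k) = V k"
    using k by (intro subspace_dim_equal) (auto simp: V_def)
  moreover have "mat_power A k \<in> V k"
    unfolding V_def by (intro span_base) auto
  ultimately have "mat_power A k \<in> span (mat_power A ` {Suc k..})"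
    by (simp add: V_def)
  then have "\<exists>Y. A ** Y = Y ** A \<and> mat_power A k = mat_power A (Suc k) ** Y"
  proof (induction rule: span_induct_alt)
    case base
    show ?case
      by (rule exI[of _ 0]) simp
  next
    case (step c B C)
    from step.hyps obtain j where j: "j \<ge> Suc k" "B = mat_power A j" by auto
    from step.IH obtain Y where Y: "A ** Y = Y ** A" "C = mat_power A (Suc k) ** Y" by auto
    have "B = mat_power A (Suc k) ** mat_power A (j - Suc k)"
      using j by (simp flip: mat_power_add)
    then have "c *\<^sub>R B + C = mat_power A (Suc k) ** (c *\<^sub>R mat_power A (j - Suc k) + Y)"
      by (simp add: Y matrix_add_ldistrib matrix_scalar_ac scalar_matrix_assoc)
    moreover have "A ** (c *\<^sub>R mat_power A (j - Suc k) + Y) = (c *\<^sub>R mat_power A (j - Suc k) + Y) ** A"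
      by (simp add: Y matrix_add_ldistrib matrix_add_rdistrib matrix_scalar_ac
          mat_power_commute[of A A] flip: scalar_matrix_assoc)
    ultimately show ?case
      by blast
  qed
  then show thesis
    using that by blast
qed

lemma is_drazin_exists:
  fixes A :: "complex^'n^'n"
  shows "\<exists>X. is_drazin A X"
proof -
  obtain k Y where AY: "A ** Y = Y ** A" and k: "mat_power A k = mat_power A (Suc k) ** Y"
    by (rule mat_power_stabilizes)
  define X where "X = mat_power A k ** mat_power Y (Suc k)"
  \<comment> \<open>Each use of \<open>k\<close> trades one factor A against one factor
    \<open>Y\<close>; at m = k + 1 this is the power condition for \<open>X\<close>.\<close>
  have shift: "mat_power A (k + m) ** mat_power Y m = mat_power A k" for m
  proof (induction m)
    case (Suc m)
    have "mat_power A (k + Suc m) = mat_power A m ** mat_power A (Suc k)"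
      by (simp add: add.commute flip: mat_power_add)
    then have "mat_power A (k + Suc m) ** mat_power Y (Suc m)
        = mat_power A m ** (mat_power A (Suc k) ** Y) ** mat_power Y m"
      by (simp add: mat_power_Suc[of Y] matrix_mul_assoc)
    also have "\<dots> = mat_power A (k + m) ** mat_power Y m"
      using k by (metis add.commute mat_power_add)
    finally show ?case
      using Suc by simp
  qed simp
  have YA: "mat_power Y m ** A = A ** mat_power Y m" for m
    using mat_power_commute[OF AY[symmetric]] .
  have AX: "A ** X = X ** A"
    using YA[of "Suc k"] mat_power_commute[of A A k] by (metis X_def matrix_mul_assoc)
  have pow: "mat_power A (Suc k) ** X = mat_power A k"
    using shift[of "Suc k"]
    by (simp add: X_def matrix_mul_assoc add.commute flip: mat_power_add)
  have "X ** A ** X = A ** X ** X"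
    by (simp add: AX)
  also have "\<dots> = mat_power A (Suc k) ** X ** mat_power Y (Suc k)"
    using mat_power_commute[OF AX, of k] by (metis X_def mat_power_Suc matrix_mul_assoc)
  also have "\<dots> = X"
    unfolding pow by (simp add: X_def)
  finally show ?thesis
    using AX pow unfolding is_drazin_def by blast
qed

text \<open>Iterating X = X (X A), which is X A X = X with the factors commuted. It brings in an
  arbitrarily high power of A, to which the power condition of another Drazin inverse can then be
  applied.\<close>

lemma drazin_eq_power_mult:
  assumes "X ** A ** X = X" and "A ** X = X ** A"
  shows "mat_power X (Suc m) ** mat_power A m = X"
    and "mat_power A m ** mat_power X (Suc m) = X"
proof -
  show *: "mat_power X (Suc m) ** mat_power A m = X"
  proof (induction m)
    case (Suc m)
    have "mat_power X (Suc (Suc m)) ** mat_power A (Suc m)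
        = X ** (mat_power X (Suc m) ** mat_power A m) ** A"
      by (simp only: mat_power_Suc[of X "Suc m"] mat_power_Suc2[of A] matrix_mul_assoc)
    also have "\<dots> = X"
      by (metis Suc assms matrix_mul_assoc)
    finally show ?case .
  qed simp
  have "mat_power A m ** X = X ** mat_power A m"
    by (rule mat_power_commute) fact
  then show "mat_power A m ** mat_power X (Suc m) = X"
    using * mat_power_commute[of X "mat_power A m" "Suc m"] by metis
qed

lemma is_drazin_unique:
  assumes "is_drazin A X" and "is_drazin A Y"
  shows "X = Y"
proof -
  have X: "X ** A ** X = X" "A ** X = X ** A" and Y: "Y ** A ** Y = Y" "A ** Y = Y ** A"
    using assms by (auto simp: is_drazin_def)
  obtain k l where k: "mat_power A (Suc k) ** X = mat_power A k"
    and l: "mat_power A (Suc l) ** Y = mat_power A l"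
    using assms by (auto simp: is_drazin_def)
  \<comment> \<open>The two exponents may differ; the power condition persists at every larger
    exponent, so their sum serves both.\<close>
  define m where "m = k + l"
  have mX: "mat_power A (Suc m) ** X = mat_power A m"
    using k by (metis add.commute add_Suc_right m_def mat_power_add matrix_mul_assoc)
  have mY: "mat_power A (Suc m) ** Y = mat_power A m"
    using l by (metis add_Suc_right m_def mat_power_add matrix_mul_assoc)
  \<comment> \<open>Replace A^m by A^(m+1) Y inside X = X^(m+1) A^m. The mirrored replacement in Y =
    A^m Y^(m+1) below reaches the same X A Y.\<close>
  have "X = mat_power X (Suc m) ** mat_power A m ** A ** Y"
    using drazin_eq_power_mult(1)[OF X, of m] mY by (metis mat_power_Suc2 matrix_mul_assoc)
  then have "X = X ** A ** Y"
    by (simp add: drazin_eq_power_mult(1)[OF X])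
  moreover have "Y = X ** A ** (mat_power A m ** mat_power Y (Suc m))"
    using drazin_eq_power_mult(2)[OF Y, of m] mX
    by (metis X(2) mat_power_Suc mat_power_commute matrix_mul_assoc)
  then have "Y = X ** A ** Y"
    by (simp add: drazin_eq_power_mult(2)[OF Y])
  ultimately show ?thesis
    by simp
qed

lemma is_drazin_drazin: "is_drazin A (drazin A)"
  unfolding drazin_def using is_drazin_exists is_drazin_unique by (metis theI')

text \<open>A X is idempotent, and A and X invert each other on its range. At k = 0 the products
  would be the identity instead, hence k > 0.\<close>

lemma mat_power_mult_drazin:
  assumes "X ** A ** X = X" and "X ** A = A ** X" and "k > 0"
  shows "mat_power X k ** mat_power A k = A ** X"
    and "mat_power A k ** mat_power X k = A ** X"
proof -
  obtain m where k: "k = Suc m"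
    using \<open>k > 0\<close> by (cases k) auto
  have "mat_power X k ** mat_power A k = mat_power X (Suc m) ** mat_power A m ** A"
    by (simp add: k mat_power_Suc2[of A] matrix_mul_assoc)
  then show "mat_power X k ** mat_power A k = A ** X"
    using assms(2) by (simp only: drazin_eq_power_mult(1)[OF assms(1) assms(2)[symmetric]])
  have "mat_power A k ** mat_power X k = A ** (mat_power A m ** mat_power X (Suc m))"
    by (simp add: k mat_power_Suc[of A] matrix_mul_assoc)
  then show "mat_power A k ** mat_power X k = A ** X"
    using assms(2) by (simp only: drazin_eq_power_mult(2)[OF assms(1) assms(2)[symmetric]])
qed

section \<open>The Moore-Penrose inverse\<close>

lemma conj_transpose_mult: "conj_transpose (A ** B) = conj_transpose B ** conj_transpose A"
  by (simp add: conj_transpose_def map_matrix_def transpose_def matrix_matrix_mult_def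
      vec_eq_iff mult.commute)

lemma conj_transpose_conj_transpose [simp]: "conj_transpose (conj_transpose A) = A"
  by (simp add: conj_transpose_def map_matrix_def transpose_def vec_eq_iff)

lemma conj_transpose_mat_1 [simp]: "conj_transpose (mat 1) = mat 1"
  by (simp add: conj_transpose_def map_matrix_def transpose_def mat_def vec_eq_iff)

lemma conj_transpose_mat_power: "conj_transpose (mat_power A k) = mat_power (conj_transpose A) k"
  by (induction k) (simp, metis conj_transpose_mult mat_power_Suc mat_power_Suc2)

lemma conj_transpose_mult_self_eq_0:
  assumes "conj_transpose A ** A = 0"
  shows "A = 0"
proof -
  have "A $ k $ i = 0" for k i
  proof -
    \<comment> \<open>A diagonal entry of A* A is the squared norm of a column of A.\<close>
    have "complex_of_real (\<Sum>k\<in>UNIV. (norm (A $ k $ i))\<^sup>2) = (conj_transpose A ** A) $ i $ i"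
      by (simp add: conj_transpose_def map_matrix_def transpose_def matrix_matrix_mult_def
          complex_norm_square mult.commute del: of_real_power)
    then have "(\<Sum>k\<in>UNIV. (norm (A $ k $ i))\<^sup>2) = 0"
      using assms by (simp del: of_real_sum of_real_power)
    then show ?thesis
      by (simp add: sum_nonneg_eq_0_iff)
  qed
  then show ?thesis
    by (simp add: vec_eq_iff)
qed

text \<open>If A* A Z = 0 then (A Z)* (A Z) = Z* A* A Z = 0, so A Z = 0; take Z = X - Y.\<close>

lemma conj_transpose_mult_left_cancel:
  assumes "conj_transpose A ** A ** X = conj_transpose A ** A ** Y"
  shows "A ** X = A ** Y"
proof -
  have "conj_transpose A ** (A ** (X - Y)) = 0"
    using assms by (simp add: matrix_diff_ldistrib matrix_mul_assoc)
  then have "conj_transpose (A ** (X - Y)) ** (A ** (X - Y)) = 0"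
    by (simp add: conj_transpose_mult flip: matrix_mul_assoc)
  then have "A ** (X - Y) = 0"
    by (rule conj_transpose_mult_self_eq_0)
  then show ?thesis
    by (simp add: matrix_diff_ldistrib)
qed

lemma is_moore_penrose_exists: "\<exists>X. is_moore_penrose A X"
proof -
  define H where "H = conj_transpose A ** A"
  define G where "G = drazin H"
  have H: "conj_transpose H = H"
    by (simp add: H_def conj_transpose_mult)
  have G: "G ** H ** G = G" "H ** G = G ** H"
    using is_drazin_drazin[of H] by (auto simp: is_drazin_def G_def)
  obtain k where k: "mat_power H (Suc k) ** G = mat_power H k"
    using is_drazin_drazin[of H] by (auto simp: is_drazin_def G_def)
  \<comment> \<open>Taking adjoints of the Drazin equations of the Hermitian \<open>H\<close> gives
    them for G*, so uniqueness makes \<open>G\<close> Hermitian.\<close>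
  have "is_drazin H (conj_transpose G)"
    unfolding is_drazin_def
  proof (intro conjI exI)
    show "conj_transpose G ** H ** conj_transpose G = conj_transpose G"
      using G(1) H by (metis conj_transpose_mult matrix_mul_assoc)
    show HG: "H ** conj_transpose G = conj_transpose G ** H"
      using G(2) H by (metis conj_transpose_mult)
    show "mat_power H (Suc k) ** conj_transpose G = mat_power H k"
      using k H HG by (metis conj_transpose_mult conj_transpose_mat_power mat_power_commute)
  qed
  then have Gh: "conj_transpose G = G"
    using is_drazin_drazin[of H] is_drazin_unique by (auto simp: G_def)
  \<comment> \<open>Since H = H*, a leading H H equals H* H and one factor \<open>H\<close> cancels.
    This lowers the exponent step by step down to 1.\<close>
  have "mat_power H (Suc j) ** G = mat_power H j \<Longrightarrow> H ** H ** G = H" for j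
  proof (induction j)
    case 0
    then show ?case by (simp flip: matrix_mul_assoc)
  next
    case (Suc j)
    show ?case
    proof (cases j)
      case 0
      then show ?thesis using Suc.prems by (simp add: mat_power_Suc)
    next
      case (Suc i)
      have "H ** H ** (mat_power H (Suc i) ** G) = H ** H ** mat_power H i"
        using Suc.prems Suc by (simp add: mat_power_Suc matrix_mul_assoc)
      then have "H ** (mat_power H (Suc i) ** G) = H ** mat_power H i"
        using conj_transpose_mult_left_cancel[of H] H by simp
      then show ?thesis
        using Suc.IH Suc by (simp add: mat_power_Suc matrix_mul_assoc)
    qed
  qed
  \<comment> \<open>Reading H H G = H as A* A (H G) = A* A lets A* be cancelled.\<close>
  with k have "conj_transpose A ** A ** (H ** G) = conj_transpose A ** A ** mat 1"
    by (simp add: H_def matrix_mul_assoc)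
  then have AHG: "A ** (H ** G) = A"
    using conj_transpose_mult_left_cancel[of A] by fastforce
  have "is_moore_penrose A (G ** conj_transpose A)"
    unfolding is_moore_penrose_def
  proof (intro conjI)
    show "A ** (G ** conj_transpose A) ** A = A"
      using AHG G(2) by (simp add: H_def flip: matrix_mul_assoc)
    show "G ** conj_transpose A ** A ** (G ** conj_transpose A) = G ** conj_transpose A"
      using G(1) by (simp add: H_def matrix_mul_assoc)
    show "conj_transpose (A ** (G ** conj_transpose A)) = A ** (G ** conj_transpose A)"
      by (simp add: conj_transpose_mult Gh matrix_mul_assoc)
    show "conj_transpose (G ** conj_transpose A ** A) = G ** conj_transpose A ** A"
      using G(2) H Gh by (metis H_def conj_transpose_mult matrix_mul_assoc)
  qed
  then show ?thesis
    by blast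
qed

lemma is_moore_penrose_unique:
  assumes "is_moore_penrose A X" and "is_moore_penrose A Y"
  shows "X = Y"
proof -
  have X: "A ** X ** A = A" "X ** A ** X = X" "conj_transpose (A ** X) = A ** X"
    "conj_transpose (X ** A) = X ** A"
    and Y: "A ** Y ** A = A" "Y ** A ** Y = Y" "conj_transpose (A ** Y) = A ** Y"
    "conj_transpose (Y ** A) = Y ** A"
    using assms by (auto simp: is_moore_penrose_def)
  \<comment> \<open>A X = (A Y)(A X) by A Y A = A. Taking adjoints swaps the two Hermitian factors,
    and (A X)(A Y) collapses to A Y. The same argument gives X A = Y A.\<close>
  have "A ** X = conj_transpose ((A ** Y) ** (A ** X))"
    using X Y by (simp add: matrix_mul_assoc)
  then have AXY: "A ** X = A ** Y"
    using X Y by (metis conj_transpose_mult matrix_mul_assoc)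
  have "X ** A = conj_transpose ((X ** A) ** (Y ** A))"
    using X Y by (simp flip: matrix_mul_assoc)
  then have "X ** A = Y ** A"
    using X Y by (metis conj_transpose_mult matrix_mul_assoc)
  then show ?thesis
    using AXY X(2) Y(2) by (metis matrix_mul_assoc)
qed

lemma is_moore_penrose_moore_penrose: "is_moore_penrose A (moore_penrose A)"
  unfolding moore_penrose_def
  using is_moore_penrose_exists is_moore_penrose_unique by (metis theI')

section \<open>Characterizations of core-EP matrices\<close>

theorem corollary4:
  fixes A :: "complex^'n^'n"
  shows "(core_EP A \<longleftrightarrow> MPDMP A = mat_power (drazin A) 3) \<and>
         (core_EP A \<longleftrightarrow> MPDMP A ** DMP A = mat_power (drazin A) 4) \<and>
         (core_EP A \<longleftrightarrow> MPDMP A ** A = A ** MPDMP A) \<and>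
         (core_EP A \<longleftrightarrow> MPDMP A ** core_part A = core_part A ** MPDMP A) \<and>
         (core_EP A \<longleftrightarrow> MPDMP A ** drazin A = drazin A ** MPDMP A) \<and>
         (core_EP A \<longleftrightarrow> MPDMP A ** drazin A = mat_power (DMP A) 4)"
proof -
  define M D where "M = moore_penrose A" and "D = drazin A"
  define P Q R where "P = A ** D" and "Q = M ** A" and "R = A ** M"
  have M: "A ** M ** A = A" "M ** A ** M = M"
    using is_moore_penrose_moore_penrose[of A] by (auto simp: is_moore_penrose_def M_def)
  have D: "D ** A ** D = D" "D ** A = A ** D"
    using is_drazin_drazin[of A] by (auto simp: is_drazin_def D_def)
  have QQ: "Q ** Q = Q" and RR: "R ** R = R" and AQ: "A ** Q = A" and RA: "R ** A = A"
    using M by (simp_all add: Q_def R_def matrix_mul_assoc)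
  have PQ: "P ** Q = P" and RP: "R ** P = P" and PP: "P ** P = P"
    using D AQ RA by (metis P_def matrix_mul_assoc)+
  have PD: "P ** D = D" and DP: "D ** P = D"
    using D by (metis P_def matrix_mul_assoc)+
  have PA: "P ** A = A ** P"
    using D by (metis P_def matrix_mul_assoc)
  have RD: "R ** D = D" and DQ: "D ** Q = D"
    using RP PQ PD DP by (metis matrix_mul_assoc)+
  have DkAk: "mat_power D k ** mat_power A k = P" "mat_power A k ** mat_power D k = P" if "k > 0" for k
    using mat_power_mult_drazin[OF D that] by (simp_all add: P_def)
  have PDk: "P ** mat_power D k = mat_power D k" "mat_power D k ** P = mat_power D k" if "k > 0" for k
    using that PD DP
    by (metis gr0_implies_Suc mat_power_Suc mat_power_Suc2 matrix_mul_assoc)+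
  define S where "S \<longleftrightarrow> Q ** P = P \<and> P ** R = P"
  \<comment> \<open>Right multiplication by A^k turns D^k into \<open>P\<close>; right
    multiplication by D^k turns \<open>P\<close> back into D^k.\<close>
  have QDk: "Q ** mat_power D k = mat_power D k \<longleftrightarrow> Q ** P = P" if "k > 0" for k
    using DkAk(1)[OF that] PDk(1)[OF that] by (metis matrix_mul_assoc)
  have DkR: "mat_power D k ** R = mat_power D k \<longleftrightarrow> P ** R = P" if "k > 0" for k
    using DkAk(2)[OF that] PDk(2)[OF that] by (metis matrix_mul_assoc)
  have comm: "(Q ** mat_power D k = mat_power D k ** R) = S" if "k > 0" for k
  proof
    assume eq: "Q ** mat_power D k = mat_power D k ** R"
    \<comment> \<open>As P Q = P, the left side becomes D^k, so D^k R = D^k, and then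
      \<open>eq\<close> also gives Q D^k = D^k.\<close>
    then have "P ** Q ** mat_power D k = P ** mat_power D k ** R"
      by (metis matrix_mul_assoc)
    then show S
      using that eq QDk[OF that] DkR[OF that] by (simp add: PQ PDk S_def)
  qed (use QDk[OF that] DkR[OF that] S_def in metis)
  \<comment> \<open>Idempotence of \<open>Q\<close> and \<open>R\<close> lets either one be absorbed
    into Q D^k R, so D^k is fixed by both.\<close>
  have both: "(Q ** mat_power D k ** R = mat_power D k) = S" if "k > 0" for k
    using QDk[OF that] DkR[OF that] QQ RR S_def by (metis matrix_mul_assoc)
  have core: "core_part A = A ** P"
    using PA by (simp add: core_part_def D_def P_def)
  have iEP: "core_EP A = S"
  proof -
    have "core_EP A \<longleftrightarrow> Q ** P = P ** R"
      using PA by (simp add: core_EP_def core Q_def R_def M_def matrix_mul_assoc)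
    then show ?thesis
      using PQ PP unfolding S_def by (metis matrix_mul_assoc)
  qed
  define E where "E = M ** D ** M"
  have E: "E = Q ** mat_power D 3 ** R"
  proof -
    have "D = A ** (D ** D ** D) ** A"
      using D by (metis matrix_mul_assoc)
    then have "E = M ** (A ** (D ** D ** D) ** A) ** M"
      by (simp only: E_def)
    then show ?thesis
      by (simp add: Q_def R_def numeral_3_eq_3 mat_power_Suc matrix_mul_assoc)
  qed
  have DMP: "DMP A = D ** R"
    by (simp add: DMP_def D_def M_def R_def matrix_mul_assoc)
  have ADk: "A ** mat_power D (Suc (Suc k)) = mat_power D (Suc k)"
    "mat_power D (Suc (Suc k)) ** A = mat_power D (Suc k)" for k
    using PD DP D(2) by (metis P_def mat_power_Suc mat_power_Suc2 matrix_mul_assoc)+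
  have RDk: "R ** mat_power D (Suc k) = mat_power D (Suc k)" for k
    using RD by (metis mat_power_Suc matrix_mul_assoc)
  \<comment> \<open>R D = D removes every \<open>R\<close> but the last.\<close>
  have DR: "mat_power (D ** R) (Suc k) = mat_power D (Suc k) ** R" for k
  proof (induction k)
    case (Suc k)
    then show ?case
      using RDk by (metis mat_power_Suc matrix_mul_assoc)
  qed simp
  have D34: "mat_power D 4 = mat_power D 3 ** D" "mat_power D 4 = D ** mat_power D 3"
    using mat_power_Suc[of D 3] mat_power_Suc2[of D 3] by simp_all
  have AD3: "A ** mat_power D 3 = mat_power D 2" "mat_power D 3 ** A = mat_power D 2"
    using ADk[of 1] by (simp_all add: numeral_3_eq_3 numeral_2_eq_2)
  \<comment> \<open>Conditions (ii) and (iii) are instances of \<open>both\<close> with exponents 3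
    and 4; (iv) and (v) are \<open>comm\<close> with exponent 2, (vi) and (vii) \<open>comm\<close>
    with exponent 4.\<close>
  have "(E = mat_power D 3) = S"
    using both[of 3] by (simp add: E)
  moreover have "E ** (D ** R) = Q ** mat_power D 4 ** R"
    using RD by (metis E D34(1) matrix_mul_assoc)
  moreover have EA: "E ** A = Q ** mat_power D 2"
    using RA AD3(2) by (metis E matrix_mul_assoc)
  moreover have AE: "A ** E = mat_power D 2 ** R"
    using AQ AD3(1) by (metis E matrix_mul_assoc)
  moreover have "E ** core_part A = Q ** mat_power D 2"
    using EA PDk(2)[of 2] by (metis core matrix_mul_assoc zero_less_numeral)
  moreover have "core_part A ** E = mat_power D 2 ** R"
    using AE PDk(1)[of 2] by (metis core PA matrix_mul_assoc zero_less_numeral)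
  moreover have "E ** D = Q ** mat_power D 4"
    using RD by (metis E D34(1) matrix_mul_assoc)
  moreover have "D ** E = mat_power D 4 ** R"
    using DQ by (metis E D34(2) matrix_mul_assoc)
  moreover have "MPDMP A = E"
    by (simp add: MPDMP_def E_def M_def D_def)
  moreover have "mat_power (D ** R) 4 = mat_power D 4 ** R"
    using DR[of 3] by simp
  ultimately show ?thesis
    using comm both by (simp add: iEP DMP flip: D_def)
qed

end
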